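(* Let $A(t)$, $t\in\mathbb{Z}$, be an $n\times n$ matrix function and suppose that the system $$x(t+1)=A(t)x(t),\qquad x(t_0)=x_0,\qquad t\in\mathbb{Z},$$ admits an exponential dichotomy with the projection $P$ and the positive constants $\alpha_1,\alpha_2,\beta_1,\beta_2$. Let $A(t)$ be almost automorphic, that is, for any sequence $\{\tilde\theta_k\}_{k\in\mathbb{Z}_+}$ of integers there exists a subsequence $\{\theta_k\}_{k\in\mathbb{Z}_+}$ such that $$\lim_{k\to\infty}A(t+\theta_k)=:\bar A(t)$$ is well defined and $$\lim_{k\to\infty}\bar A(t-\theta_k)=A(t)$$ for each $t\in\mathbb{Z}$. Then, for any such $\{\theta_k\}$ and $\bar A$, with $\bar X(t)$ denoting the principal fundamental matrix solution of the limiting system $$x(t+1)=\bar A(t)x(t),\qquad x(t_0)=x_0,$$ there is a projection $\bar P$ such that the limits $$\lim_{k\to\infty}X(t+\theta_k)PX^{-1}(s+\theta_k)=\bar X(t)\bar P\bar X^{-1}(s)\quad\text{for } s\in(-\infty,t]\cap\mathbb{Z}$$ and $$\lim_{k\to\infty}X(t+\theta_k)(I-P)X^{-1}(s+\theta_k)=\bar X(t)(I-\bar P)\bar X^{-1}(s)\quad\text{for } s\in[t,\infty)\cap\mathbb{Z}$$ are well defined for each $t\in\mathbb{Z}$, and the limiting system admits an exponential dichotomy with the projection $\bar P$ and the same constants $\alpha_1,\alpha_2,\beta_1,\beta_2$. Furthermore, for each $t\in\mathbb{Z}$, $$\lim_{k\to\infty}\bar X(t-\theta_k)\bar P\bar X^{-1}(s-\theta_k)=X(t)PX^{-1}(s),\quad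 s\in(-\infty,t]\cap\mathbb{Z},$$ and $$\lim_{k\to\infty}\bar X(t-\theta_k)(I-\bar P)\bar X^{-1}(s-\theta_k)=X(t)(I-P)X^{-1}(s),\quad s\in[t,\infty)\cap\mathbb{Z}.$$
   Context: $\mathcal{X}$ is the space $\mathbb{R}^n$ or $\mathbb{C}^n$ with a norm $\|\cdot\|_{\mathcal{X}}$, and $\mathcal{B}(\mathcal{X})$ is the space of (bounded) linear operators on $\mathcal{X}$ with the operator norm $\|L\|_{\mathcal{B}(\mathcal{X})}=\sup\{\|Lx\|_{\mathcal{X}}:\|x\|_{\mathcal{X}}\le 1\}$. Fix $t_0\in\mathbb{Z}$. $X(t)$, $t\in\mathbb{Z}$, denotes the principal fundamental matrix solution of $x(t+1)=A(t)x(t)$, i.e. $X(t+1)=A(t)X(t)$ for all $t\in\mathbb{Z}$ and $X(t_0)=I$; the matrices $A(t)$ are invertible, so that $X(t)$ is defined on $\mathbb{Z}$ and $X^{-1}(s)$ denotes the inverse of $X(s)$. The principal fundamental matrix solution $\bar X(t)$ of the system with coefficient $\bar A$ is defined in the same way, with $\bar X(t_0)=I$. Exponential dichotomy: the system $x(t+1)=A(t)x(t)$, $x(t_0)=x_0$, admits an exponential dichotomy with projection $P$ (a matrix with $P^2=P$) and positive constants $\alpha_1,\alpha_2,\beta_1,\beta_2$ if, for $t,s\in\mathbb{Z}$, $$\|X(t)PX^{-1}(s)\|_{\mathcal{B}(\mathcal{X})}\le\beta_1(1+\alpha_1)^{s-t},\quad t\ge s,$$ $$\|X(t)(I-P)X^{-1}(s)\|_{\mathcal{B}(\mathcal{X})}\le\beta_2(1+\alpha_2)^{t-s},\quad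 s\ge t;$$ likewise for the system with coefficient $\bar A$, with $\bar X$ and $\bar P$ in place of $X$ and $P$.
   Formalization: The limit matrices Ā(t) are assumed invertible for every integer t, so that X̄ and its inverse exist on all integers; this can fail otherwise, e.g. A(t)=cos(t)/2 with θ_k tending to π/2 mod 2π gives Ā(0)=0. *)

theory Defs
  imports "HOL-Analysis.Analysis"
begin

text \<open>
  Throughout, the scalar type \<open>'k\<close> of sort \<open>{real_normed_field, euclidean_space}\<close>
  treats the cases \<open>real\<close> and \<open>complex\<close> simultaneously, and matrix limits refer to
  the (finite-dimensional, hence norm-independent) topology of \<open>'k^'n^'n\<close>.
\<close>

text \<open>
  An arbitrary norm on \<open>'k^'n\<close>, not just the one carried by the type.
  Homogeneity is over the scalar field \<open>'k\<close>, so in the complex case it is complex homogeneity.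
\<close>

definition is_norm :: "('k::real_normed_field ^ 'n::finite \<Rightarrow> real) \<Rightarrow> bool" where
  "is_norm N \<longleftrightarrow>
     (\<forall>x. 0 \<le> N x) \<and>
     (\<forall>x. N x = 0 \<longleftrightarrow> x = 0) \<and>
     (\<forall>c x. N (c *s x) = norm c * N x) \<and>
     (\<forall>x y. N (x + y) \<le> N x + N y)"

definition op_norm ::
  "('k::real_normed_field ^ 'n::finite \<Rightarrow> real) \<Rightarrow> 'k ^ 'n ^ 'n \<Rightarrow> real" where
  "op_norm N L = Sup {N (L *v x) | x. N x \<le> 1}"

text \<open>
  For invertible coefficients \<open>A t\<close> there is exactly one such \<open>X\<close>, and all \<open>X t\<close> are invertible.
\<close>

definition principal_fundamental_matrix ::
  "(int \<Rightarrow> 'k::real_normed_field ^ 'n::finite ^ 'n) \<Rightarrow> int \<Rightarrow> (int \<Rightarrow> 'k ^ 'n ^ 'n) \<Rightarrow> bool" where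
  "principal_fundamental_matrix A t0 X \<longleftrightarrow>
     X t0 = mat 1 \<and> (\<forall>t. X (t + 1) = A t ** X t)"

text \<open>
  The system enters through its principal fundamental matrix solution \<open>X\<close>.
\<close>

definition exponential_dichotomy ::
  "('k::real_normed_field ^ 'n::finite \<Rightarrow> real) \<Rightarrow> (int \<Rightarrow> 'k ^ 'n ^ 'n) \<Rightarrow> 'k ^ 'n ^ 'n \<Rightarrow>
   real \<Rightarrow> real \<Rightarrow> real \<Rightarrow> real \<Rightarrow> bool" where
  "exponential_dichotomy N X P \<alpha>\<^sub>1 \<alpha>\<^sub>2 \<beta>\<^sub>1 \<beta>\<^sub>2 \<longleftrightarrow>
     P ** P = P \<and> 0 < \<alpha>\<^sub>1 \<and> 0 < \<alpha>\<^sub>2 \<and> 0 < \<beta>\<^sub>1 \<and> 0 < \<beta>\<^sub>2 \<and>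
     (\<forall>t s. s \<le> t \<longrightarrow>
        op_norm N (X t ** P ** matrix_inv (X s)) \<le> \<beta>\<^sub>1 * (1 + \<alpha>\<^sub>1) powi (s - t)) \<and>
     (\<forall>t s. t \<le> s \<longrightarrow>
        op_norm N (X t ** (mat 1 - P) ** matrix_inv (X s)) \<le> \<beta>\<^sub>2 * (1 + \<alpha>\<^sub>2) powi (t - s))"

definition limits_along ::
  "(int \<Rightarrow> 'k::real_normed_field ^ 'n::finite ^ 'n) \<Rightarrow> (nat \<Rightarrow> int) \<Rightarrow> (int \<Rightarrow> 'k ^ 'n ^ 'n) \<Rightarrow> bool" where
  "limits_along A \<theta> Abar \<longleftrightarrow>
     (\<forall>t. (\<lambda>k. A (t + \<theta> k)) \<longlonglongrightarrow> Abar t) \<and>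
     (\<forall>t. (\<lambda>k. Abar (t - \<theta> k)) \<longlonglongrightarrow> A t)"

definition almost_automorphic ::
  "(int \<Rightarrow> 'k::real_normed_field ^ 'n::finite ^ 'n) \<Rightarrow> bool" where
  "almost_automorphic A \<longleftrightarrow>
     (\<forall>\<theta>' :: nat \<Rightarrow> int. \<exists>r Abar. strict_mono r \<and> limits_along A (\<theta>' \<circ> r) Abar)"

end

theory Submission
  imports Defs
begin

text \<open>
  The shifted projections \<open>X(t0 + \<theta>\<^sub>k) P X\<inverse>(t0 + \<theta>\<^sub>k)\<close> are bounded, and each of their
  subsequential limits is the projection of a dichotomy of the limiting system with the same constants,
  because the shifted transition matrices converge to those of the limiting system. A dichotomy on all
  of \<open>\<int>\<close> has only one projection, so the whole sequence converges. The limiting system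
  tends to the original one along \<open>-\<theta>\<close>, so the same argument, followed by uniqueness of the
  projection, gives the reverse limits.
\<close>

subsection \<open>Matrix limits\<close>

text \<open>In finite dimension every real bilinear map is bounded, so only additivity and real
  homogeneity in each factor have to be checked.\<close>

lemma bounded_bilinear_matrix_mult:
  "bounded_bilinear ((**) :: 'k::{real_normed_field, euclidean_space} ^ 'n::finite ^ 'm::finite
     \<Rightarrow> 'k ^ 'p::finite ^ 'n \<Rightarrow> 'k ^ 'p ^ 'm)"
  unfolding bilinear_conv_bounded_bilinear[symmetric] bilinear_def
  by (auto intro!: linearI simp: vec_eq_iff matrix_matrix_mult_def sum.distrib algebra_simps
      scaleR_sum_right)

lemmas tendsto_matrix_mult = bounded_bilinear.tendsto[OF bounded_bilinear_matrix_mult]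

lemma bounded_bilinear_matrix_vector_mult:
  "bounded_bilinear ((*v) :: 'k::{real_normed_field, euclidean_space} ^ 'n::finite ^ 'm::finite
     \<Rightarrow> 'k ^ 'n \<Rightarrow> 'k ^ 'm)"
  unfolding bilinear_conv_bounded_bilinear[symmetric] bilinear_def
  by (auto intro!: linearI simp: vec_eq_iff matrix_vector_mult_def sum.distrib algebra_simps
      scaleR_sum_right)

text \<open>\<open>matrix_inv\<close> is a choice among two-sided inverses, so its defining
  equations become available once one is known to exist.\<close>

lemma invertible_matrix_inv_right:
  "invertible (M :: 'k::semiring_1 ^ 'n ^ 'n) \<Longrightarrow> M ** matrix_inv M = mat 1"
  unfolding invertible_def matrix_inv_def by (rule someI2_ex) auto

lemma invertible_matrix_inv_left:
  "invertible (M :: 'k::semiring_1 ^ 'n ^ 'n) \<Longrightarrow> matrix_inv M ** M = mat 1"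
  unfolding invertible_def matrix_inv_def by (rule someI2_ex) auto

lemma matrix_inv_eqI:
  fixes M B :: "'k::semiring_1 ^ 'n ^ 'n"
  assumes "M ** B = mat 1" "B ** M = mat 1"
  shows "matrix_inv M = B"
proof -
  have "invertible M"
    using assms by (auto simp: invertible_def)
  then have "matrix_inv M ** (M ** B) = B"
    by (simp add: matrix_mul_assoc invertible_matrix_inv_left)
  then show ?thesis
    by (simp add: assms)
qed

lemma matrix_inv_mat_1: "matrix_inv (mat 1 :: 'k::semiring_1 ^ 'n ^ 'n) = mat 1"
  by (rule matrix_inv_eqI) simp_all

text \<open>The resolvent identity bounds the error of the inverses by \<open>norm (G k)\<close>
  times a null sequence; the unknown factor \<open>norm (G k)\<close> is absorbed as soon as that
  sequence is below 1/2.\<close>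

lemma tendsto_matrix_inv:
  fixes F :: "nat \<Rightarrow> 'k::{real_normed_field, euclidean_space} ^ 'n::finite ^ 'n"
  assumes F: "F \<longlonglongrightarrow> M" and inv: "\<And>k. invertible (F k)" "invertible M"
  shows "(\<lambda>k. matrix_inv (F k)) \<longlonglongrightarrow> matrix_inv M"
proof -
  obtain K where K: "0 \<le> K" "\<And>(a::'k^'n^'n) (b::'k^'n^'n). norm (a ** b) \<le> norm a * norm b * K"
    using bounded_bilinear.nonneg_bounded[OF bounded_bilinear_matrix_mult] by metis
  define B where "B = matrix_inv M"
  define G where "G k = matrix_inv (F k)" for k
  \<comment> \<open>\<open>K\<close> enters twice because the resolvent identity has a product of
    three matrices; the norm of the third, \<open>B\<close>, is fixed.\<close>
  define C where "C = K * norm B * K"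
  define \<delta> where "\<delta> k = C * norm (M - F k)" for k
  have \<delta>: "\<delta> \<longlonglongrightarrow> 0"
    unfolding \<delta>_def by (rule tendsto_eq_intros F refl | simp)+
  have resolvent: "G k - B = G k ** (M - F k) ** B" for k
  proof -
    have "G k ** (M - F k) ** B = G k ** (M ** B) - (G k ** F k) ** B"
      by (simp add: bounded_bilinear.diff_left[OF bounded_bilinear_matrix_mult]
          bounded_bilinear.diff_right[OF bounded_bilinear_matrix_mult] matrix_mul_assoc)
    then show ?thesis
      by (simp add: G_def B_def invertible_matrix_inv_left invertible_matrix_inv_right inv)
  qed
  have bound: "norm (G k - B) \<le> norm (G k) * \<delta> k" for k
  proof -
    have "norm (G k - B) \<le> norm (G k ** (M - F k)) * norm B * K"
      unfolding resolvent by (rule K)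
    also have "\<dots> \<le> (norm (G k) * norm (M - F k) * K) * norm B * K"
      by (intro mult_right_mono K) (auto simp: K)
    finally show ?thesis
      by (simp add: \<delta>_def C_def mult_ac)
  qed
  \<comment> \<open>With \<open>\<delta> k < 1/2\<close> the triangle inequality reads
    \<open>norm (G k) \<le> norm B + norm (G k) / 2\<close>, an a priori bound on the inverses that
    makes the error estimate linear in \<open>\<delta> k\<close>.\<close>
  have "\<forall>\<^sub>F k in sequentially. \<delta> k < 1/2"
    using \<delta> by (rule order_tendstoD) simp
  then have "\<forall>\<^sub>F k in sequentially. norm (G k - B) \<le> 2 * norm B * \<delta> k"
  proof eventually_elim
    case (elim k)
    have \<delta>0: "0 \<le> \<delta> k"
      by (simp add: \<delta>_def C_def K)
    have "norm (G k) \<le> norm B + norm (G k - B)"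
      using norm_triangle_ineq[of B "G k - B"] by simp
    also have "\<dots> \<le> norm B + norm (G k) * (1/2)"
      using bound[of k] mult_left_mono[of "\<delta> k" "1/2" "norm (G k)"] elim by simp
    finally have "norm (G k) \<le> 2 * norm B"
      by simp
    then show ?case
      using bound[of k] mult_right_mono[OF _ \<delta>0] by (meson order_trans)
  qed
  moreover have "(\<lambda>k. 2 * norm B * \<delta> k) \<longlonglongrightarrow> 0"
    using tendsto_mult_left[OF \<delta>, of "2 * norm B"] by simp
  ultimately have "(\<lambda>k. G k - B) \<longlonglongrightarrow> 0"
    by (rule Lim_null_comparison)
  then show ?thesis
    by (simp add: LIM_zero_iff G_def B_def)
qed

subsection \<open>Operator norms\<close>

lemma is_norm_nonneg: "is_norm N \<Longrightarrow> 0 \<le> N x"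
  unfolding is_norm_def by blast

lemma is_norm_0: "is_norm N \<Longrightarrow> N 0 = 0"
  unfolding is_norm_def by blast

lemma is_norm_sum_le:
  assumes "is_norm N"
  shows "N (\<Sum>i\<in>I. f i) \<le> (\<Sum>i\<in>I. N (f i))"
proof (induction I rule: infinite_finite_induct)
  case (insert i I)
  have "N (f i + sum f I) \<le> N (f i) + N (sum f I)"
    using assms unfolding is_norm_def by blast
  then show ?case
    using insert by simp
qed (simp_all add: is_norm_0[OF assms])

text \<open>Expand \<open>x\<close> in the standard basis over \<open>'k\<close>; each coordinate is
  at most \<open>norm x\<close>, so the sum of the norms of the unit vectors is a valid
  constant.\<close>

lemma is_norm_upper:
  fixes N :: "'k::{real_normed_field, euclidean_space} ^ 'n::finite \<Rightarrow> real"
  assumes "is_norm N"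
  obtains C where "0 \<le> C" "\<And>x. N x \<le> C * norm x"
proof
  show "0 \<le> (\<Sum>i\<in>UNIV. N (axis i 1))"
    by (intro sum_nonneg is_norm_nonneg assms)
  show "N x \<le> (\<Sum>i\<in>UNIV. N (axis i 1)) * norm x" for x
  proof -
    have "N x = N (\<Sum>i\<in>UNIV. x $ i *s axis i 1)"
      by (simp add: basis_expansion)
    also have "\<dots> \<le> (\<Sum>i\<in>UNIV. N (x $ i *s axis i 1))"
      by (rule is_norm_sum_le[OF assms])
    also have "\<dots> = (\<Sum>i\<in>UNIV. norm (x $ i) * N (axis i 1))"
      using assms by (simp add: is_norm_def)
    also have "\<dots> \<le> (\<Sum>i\<in>UNIV. norm x * N (axis i 1))"
      using assms by (intro sum_mono mult_right_mono) (auto simp: is_norm_def Finite_Cartesian_Product.norm_nth_le)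
    finally show ?thesis
      by (simp add: sum_distrib_left mult.commute)
  qed
qed

text \<open>The reverse triangle inequality and the upper comparison make \<open>N\<close>
  Lipschitz.\<close>

lemma is_norm_continuous:
  fixes N :: "'k::{real_normed_field, euclidean_space} ^ 'n::finite \<Rightarrow> real"
  assumes "is_norm N"
  shows "continuous_on UNIV N"
proof -
  obtain C where C: "0 \<le> C" "\<And>x. N x \<le> C * norm x"
    using is_norm_upper[OF assms] by blast
  have *: "N x - N y \<le> C * norm (x - y)" for x y
  proof -
    have "N (y + (x - y)) \<le> N y + N (x - y)"
      using assms unfolding is_norm_def by blast
    then show ?thesis
      using C(2)[of "x - y"] by simp
  qed
  have "dist (N x) (N y) \<le> C * dist x y" for x y
    using *[of x y] *[of y x] by (simp add: dist_norm norm_minus_commute abs_le_iff)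
  then have "C-lipschitz_on UNIV N"
    using C(1) by (intro lipschitz_onI)
  then show ?thesis
    by (rule lipschitz_on_continuous_on)
qed

text \<open>By compactness \<open>N\<close> attains a minimum on the unit sphere; it is positive by
  definiteness, and homogeneity carries it to all vectors.\<close>

lemma is_norm_lower:
  fixes N :: "'k::{real_normed_field, euclidean_space} ^ 'n::finite \<Rightarrow> real"
  assumes "is_norm N"
  obtains c where "0 \<le> c" "\<And>x. norm x \<le> c * N x"
proof -
  obtain z where z: "norm z = 1" "\<And>y. norm y = 1 \<Longrightarrow> N z \<le> N y"
  proof -
    obtain b :: "'k^'n" where "b \<in> Basis"
      using nonempty_Basis by blast
    then have "sphere (0::'k^'n) 1 \<noteq> {}"
      by (auto intro!: exI[of _ b] simp: norm_Basis)
    then show thesis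
      using continuous_attains_inf[OF compact_sphere, of 0 1 N]
        continuous_on_subset[OF is_norm_continuous[OF assms]] that
      by auto
  qed
  have pos: "0 < N z"
    using z(1) assms unfolding is_norm_def by (metis less_eq_real_def norm_zero zero_neq_one)
  show thesis
  proof
    show "0 \<le> 1 / N z"
      using pos by simp
    show "norm x \<le> 1 / N z * N x" for x
    proof (cases "x = 0")
      case True
      then show ?thesis
        by (simp add: is_norm_0[OF assms])
    next
      case False
      have "N z \<le> N ((1 / norm x) *\<^sub>R x)"
        using False by (intro z(2)) simp
      \<comment> \<open>Homogeneity in \<open>is_norm\<close> is over \<open>'k\<close>, so the real
        scaling is rewritten as one by an embedded scalar.\<close>
      also have "(1 / norm x) *\<^sub>R x = of_real (1 / norm x) *s x"
        by (simp add: vec_eq_iff) (simp add: scaleR_conv_of_real)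
      also have "N (of_real (1 / norm x) *s x) = norm (of_real (1 / norm x) :: 'k) * N x"
        using assms unfolding is_norm_def by blast
      also have "\<dots> = N x / norm x"
        by (subst norm_of_real) simp
      finally show ?thesis
        using False pos by (simp add: field_simps)
    qed
  qed
qed

text \<open>A real \<open>Sup\<close> says nothing about an unbounded set; this makes
  \<open>op_norm\<close> a genuine supremum, and thus an upper bound for its members.\<close>

lemma bdd_above_op_norm:
  fixes N :: "'k::{real_normed_field, euclidean_space} ^ 'n::finite \<Rightarrow> real"
  assumes "is_norm N"
  shows "bdd_above {N (L *v x) | x. N x \<le> 1}"
proof -
  obtain C where C: "0 \<le> C" "\<And>x. N x \<le> C * norm x"
    using is_norm_upper[OF assms] by blast
  obtain c where c: "0 \<le> c" "\<And>x. norm x \<le> c * N x"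
    using is_norm_lower[OF assms] by blast
  obtain K where K: "0 \<le> K" "\<And>(a::'k^'n^'n) (b::'k^'n). norm (a *v b) \<le> norm a * norm b * K"
    using bounded_bilinear.nonneg_bounded[OF bounded_bilinear_matrix_vector_mult] by metis
  show ?thesis
  proof (rule bdd_aboveI)
    fix y assume "y \<in> {N (L *v x) | x. N x \<le> 1}"
    then obtain x where x: "y = N (L *v x)" "N x \<le> 1"
      by blast
    have "norm x \<le> c"
      using c(2)[of x] mult_left_mono[OF x(2) c(1)] by simp
    then have "norm (L *v x) \<le> norm L * c * K"
      by (intro order_trans[OF K(2)] mult_right_mono mult_left_mono K) auto
    then show "y \<le> C * (norm L * c * K)"
      unfolding x(1) by (intro order_trans[OF C(2)] mult_left_mono C)
  qed
qed

lemma op_norm_ge: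
  fixes N :: "'k::{real_normed_field, euclidean_space} ^ 'n::finite \<Rightarrow> real"
  assumes "is_norm N"
  shows "N (L *v x) \<le> op_norm N L * N x"
proof (cases "x = 0")
  case True
  then show ?thesis
    by (simp add: is_norm_0[OF assms])
next
  case False
  have hom: "\<And>c y. N (c *s y) = norm c * N y"
    using assms unfolding is_norm_def by blast
  have pos: "0 < N x"
    using False assms unfolding is_norm_def by (metis less_eq_real_def)
  define a where "a = (of_real (1 / N x) :: 'k)"
  have a: "norm a = 1 / N x"
    unfolding a_def using pos by (subst norm_of_real) simp
  have "N (L *v (a *s x)) \<le> op_norm N L"
    unfolding op_norm_def
    by (rule cSup_upper[OF _ bdd_above_op_norm[OF assms]]) (use pos in \<open>auto simp: hom a\<close>)
  also have "L *v (a *s x) = a *s (L *v x)"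
    by (simp add: vector_scalar_commute)
  finally show ?thesis
    using pos by (simp add: hom a field_simps)
qed

lemma op_norm_leI:
  assumes "is_norm N" "\<And>x. N x \<le> 1 \<Longrightarrow> N (L *v x) \<le> b"
  shows "op_norm N L \<le> b"
  unfolding op_norm_def
proof (rule cSup_least)
  have "N 0 \<le> 1"
    by (simp add: is_norm_0[OF assms(1)])
  then show "{N (L *v x) | x. N x \<le> 1} \<noteq> {}"
    by blast
qed (use assms(2) in auto)

text \<open>Carries the dichotomy estimates to the limiting system: the images of a fixed
  \<open>x\<close> converge, and \<open>N\<close> is continuous.\<close>

lemma op_norm_le_limit:
  fixes N :: "'k::{real_normed_field, euclidean_space} ^ 'n::finite \<Rightarrow> real"
  assumes "is_norm N" and lim: "F \<longlonglongrightarrow> L" and le: "\<And>k. op_norm N (F k) \<le> b"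
  shows "op_norm N L \<le> b"
proof (rule op_norm_leI[OF assms(1)])
  fix x assume x: "N x \<le> 1"
  note nn = is_norm_nonneg[OF assms(1)]
  have "(\<lambda>k. F k *v x) \<longlonglongrightarrow> L *v x"
    by (rule bounded_bilinear.tendsto[OF bounded_bilinear_matrix_vector_mult lim tendsto_const])
  then have "(\<lambda>k. N (F k *v x)) \<longlonglongrightarrow> N (L *v x)"
    by (rule continuous_on_tendsto_compose[OF is_norm_continuous[OF assms(1)]]) auto
  \<comment> \<open>The maximum supplies the nonnegative factor that monotonicity of the product
    asks for. It equals \<open>b\<close> once \<open>0 \<le> b\<close> is read off from the member
    at the zero vector.\<close>
  moreover have "N (F k *v x) \<le> max b 0" for k
  proof -
    have "N (F k *v x) \<le> op_norm N (F k) * N x"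
      by (rule op_norm_ge[OF assms(1)])
    also have "\<dots> \<le> max b 0 * 1"
      using le[of k] x nn by (intro mult_mono) auto
    finally show ?thesis
      by simp
  qed
  moreover have "0 \<le> b"
  proof -
    have "N (F 0 *v 0) \<le> op_norm N (F 0)"
      unfolding op_norm_def
      by (rule cSup_upper[OF _ bdd_above_op_norm[OF assms(1)]])
        (auto intro!: exI[of _ 0] simp: is_norm_0[OF assms(1)])
    then show ?thesis
      using nn[of "F 0 *v 0"] le[of 0] by linarith
  qed
  ultimately show "N (L *v x) \<le> b"
    by (intro LIMSEQ_le_const2) (auto simp: max_def)
qed

text \<open>Prepares the compactness argument. The columns of a matrix are the images of the unit
  vectors, so \<open>op_norm\<close> controls every entry.\<close>

lemma op_norm_bounded_imp_bounded:
  fixes N :: "'k::{real_normed_field, euclidean_space} ^ 'n::finite \<Rightarrow> real"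
  assumes "is_norm N" and le: "\<And>k. op_norm N (F k) \<le> b"
  shows "bounded (range F)"
proof -
  obtain c where c: "0 \<le> c" "\<And>x. norm x \<le> c * N x"
    using is_norm_lower[OF assms(1)] by blast
  have entry: "norm (F k $ i $ j) \<le> c * (b * N (axis j 1))" for k i j
  proof -
    have "F k $ i $ j = (F k *v axis j 1) $ i"
      by (simp add: matrix_vector_mult_def axis_def if_distrib cong: if_cong)
    then have "norm (F k $ i $ j) \<le> norm (F k *v axis j 1)"
      by (simp add: Finite_Cartesian_Product.norm_nth_le)
    also have "\<dots> \<le> c * N (F k *v axis j 1)"
      by (rule c)
    also have "\<dots> \<le> c * (op_norm N (F k) * N (axis j 1))"
      by (intro mult_left_mono op_norm_ge assms c)
    also have "\<dots> \<le> c * (b * N (axis j 1))"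
      by (intro mult_left_mono mult_right_mono le c is_norm_nonneg assms)
    finally show ?thesis .
  qed
  have "norm (F k) \<le> (\<Sum>i\<in>(UNIV::'n set). \<Sum>j\<in>UNIV. c * (b * N (axis j 1)))" for k
  proof -
    have "norm (F k) \<le> (\<Sum>i\<in>UNIV. norm (F k $ i))"
      unfolding norm_vec_def by (rule L2_set_le_sum) simp
    also have "\<dots> \<le> (\<Sum>i\<in>UNIV. \<Sum>j\<in>UNIV. norm (F k $ i $ j))"
      by (intro sum_mono) (unfold norm_vec_def, rule L2_set_le_sum, simp)
    also have "\<dots> \<le> (\<Sum>i\<in>(UNIV::'n set). \<Sum>j\<in>UNIV. c * (b * N (axis j 1)))"
      by (intro sum_mono entry)
    finally show ?thesis .
  qed
  then show ?thesis
    by (auto simp: bounded_iff)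
qed

subsection \<open>Fundamental matrices and uniqueness of the dichotomy projection\<close>

text \<open>Induction from \<open>t0\<close> in both directions; downwards the recurrence is solved
  for the earlier value with the inverse of \<open>A (i - 1)\<close>.\<close>

lemma invertible_principal_fundamental_matrix:
  fixes A X :: "int \<Rightarrow> 'k::real_normed_field ^ 'n::finite ^ 'n"
  assumes X: "principal_fundamental_matrix A t0 X" and A: "\<And>t. invertible (A t)"
  shows "invertible (X t)"
proof (induction t rule: int_induct[where k = t0])
  case base
  show ?case
    using X by (auto simp: principal_fundamental_matrix_def invertible_def intro!: exI[of _ "mat 1"])
next
  case (step1 i)
  then show ?case
    using X A by (simp add: principal_fundamental_matrix_def invertible_mult)
next
  case (step2 i)
  have "X (i - 1 + 1) = A (i - 1) ** X (i - 1)"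
    using X unfolding principal_fundamental_matrix_def by blast
  then have "X (i - 1) = matrix_inv (A (i - 1)) ** X i"
    by (simp add: matrix_mul_assoc invertible_matrix_inv_left A)
  moreover have "invertible (matrix_inv (A (i - 1)))"
    using A invertible_matrix_inv_left invertible_matrix_inv_right unfolding invertible_def by metis
  ultimately show ?case
    using step2 by (simp add: invertible_mult)
qed

text \<open>The bound tends to 0 while \<open>v\<close> is fixed. The two rates are those of the two
  dichotomies compared in the uniqueness proof.\<close>

lemma eq_zero_if_geometric_bound:
  fixes N :: "'k::{real_normed_field, euclidean_space} ^ 'n::finite \<Rightarrow> real"
  assumes "is_norm N" "0 < a" "0 < b" and le: "\<And>n::nat. N v \<le> C * (1 + a) powi (- int n) * (1 + b) powi (- int n)"
  shows "v = 0"
proof -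
  have "(\<lambda>n. C * (1 / (1 + a)) ^ n * (1 / (1 + b)) ^ n) \<longlonglongrightarrow> C * 0 * 0"
    by (intro tendsto_intros LIMSEQ_power_zero) (use assms(2,3) in auto)
  moreover have "N v \<le> C * (1 / (1 + a)) ^ n * (1 / (1 + b)) ^ n" for n
    using le[of n] by (simp add: power_int_minus power_inverse divide_inverse)
  ultimately have "N v \<le> 0"
    by (intro LIMSEQ_le_const) auto
  then show ?thesis
    using assms(1) by (metis is_norm_def order_antisym)
qed

text \<open>
  The range of \<open>P\<close> consists of the initial values of forward bounded solutions and its kernel of those
  of backward bounded ones. Accordingly \<open>(I - Q) P\<close> is split at a time \<open>t \<rightarrow> \<infinity>\<close> and \<open>Q (I - P)\<close> at
  a time \<open>t \<rightarrow> -\<infinity>\<close>, where both factors decay.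
\<close>

lemma exponential_dichotomy_unique:
  fixes X :: "int \<Rightarrow> 'k::{real_normed_field, euclidean_space} ^ 'n::finite ^ 'n"
  assumes N: "is_norm N" and X0: "X t0 = mat 1" and inv: "\<And>t. invertible (X t)"
    and P: "exponential_dichotomy N X P \<alpha>\<^sub>1 \<alpha>\<^sub>2 \<beta>\<^sub>1 \<beta>\<^sub>2"
    and Q: "exponential_dichotomy N X Q \<gamma>\<^sub>1 \<gamma>\<^sub>2 \<delta>\<^sub>1 \<delta>\<^sub>2"
  shows "P = Q"
proof -
  note nn = is_norm_nonneg[OF N]
  \<comment> \<open>Inserting the identity as \<open>matrix_inv (X t) ** X t\<close> between
    \<open>R\<close> and \<open>S\<close> splits their product into a transition from
    \<open>t0\<close> to \<open>t\<close> followed by one from \<open>t\<close> to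
    \<open>t0\<close>; the outer factors are trivial since \<open>X t0\<close> is the
    identity.\<close>
  have comp: "N ((R ** S) *v x) \<le> a * b * N x"
    if "op_norm N (X t0 ** R ** matrix_inv (X t)) \<le> a"
      "op_norm N (X t ** S ** matrix_inv (X t0)) \<le> b" "0 \<le> a" for R S t a b x
  proof -
    have "R ** S = R ** (matrix_inv (X t) ** X t) ** S"
      by (simp add: inv invertible_matrix_inv_left)
    then have "(R ** S) *v x =
        (X t0 ** R ** matrix_inv (X t)) *v ((X t ** S ** matrix_inv (X t0)) *v x)"
      by (simp add: matrix_vector_mul_assoc matrix_mul_assoc X0 matrix_inv_mat_1)
    then have "N ((R ** S) *v x) \<le>
        op_norm N (X t0 ** R ** matrix_inv (X t)) * N ((X t ** S ** matrix_inv (X t0)) *v x)"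
      by (metis op_norm_ge[OF N])
    also have "\<dots> \<le> a * N ((X t ** S ** matrix_inv (X t0)) *v x)"
      by (intro mult_right_mono that nn)
    also have "\<dots> \<le> a * (op_norm N (X t ** S ** matrix_inv (X t0)) * N x)"
      by (intro mult_left_mono that op_norm_ge[OF N])
    also have "\<dots> \<le> a * (b * N x)"
      by (intro mult_left_mono mult_right_mono that nn)
    finally show ?thesis
      by (simp add: mult_ac)
  qed
  note bounds = P[unfolded exponential_dichotomy_def] Q[unfolded exponential_dichotomy_def]
  have "((mat 1 - Q) ** P) *v x = 0" for x
  proof (rule eq_zero_if_geometric_bound[OF N, of \<gamma>\<^sub>2 \<alpha>\<^sub>1])
    fix n :: nat
    have "N (((mat 1 - Q) ** P) *v x) \<le> \<delta>\<^sub>2 * (1 + \<gamma>\<^sub>2) powi (t0 - (t0 + int n))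
        * (\<beta>\<^sub>1 * (1 + \<alpha>\<^sub>1) powi (t0 - (t0 + int n))) * N x"
    proof (rule comp[of _ "t0 + int n"])
      have "t0 \<le> t0 + int n"
        by simp
      with bounds show
        "op_norm N (X t0 ** (mat 1 - Q) ** matrix_inv (X (t0 + int n)))
           \<le> \<delta>\<^sub>2 * (1 + \<gamma>\<^sub>2) powi (t0 - (t0 + int n))"
        "op_norm N (X (t0 + int n) ** P ** matrix_inv (X t0))
           \<le> \<beta>\<^sub>1 * (1 + \<alpha>\<^sub>1) powi (t0 - (t0 + int n))"
        by blast+
      show "0 \<le> \<delta>\<^sub>2 * (1 + \<gamma>\<^sub>2) powi (t0 - (t0 + int n))"
        using bounds by (intro mult_nonneg_nonneg zero_le_power_int) linarith+
    qed
    then show "N (((mat 1 - Q) ** P) *v x)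
        \<le> (\<delta>\<^sub>2 * \<beta>\<^sub>1 * N x) * (1 + \<gamma>\<^sub>2) powi (- int n) * (1 + \<alpha>\<^sub>1) powi (- int n)"
      by (simp add: mult_ac)
  qed (use bounds in blast)+
  moreover have "(Q ** (mat 1 - P)) *v x = 0" for x
  proof (rule eq_zero_if_geometric_bound[OF N, of \<gamma>\<^sub>1 \<alpha>\<^sub>2])
    fix n :: nat
    have "N ((Q ** (mat 1 - P)) *v x) \<le> \<delta>\<^sub>1 * (1 + \<gamma>\<^sub>1) powi (t0 - int n - t0)
        * (\<beta>\<^sub>2 * (1 + \<alpha>\<^sub>2) powi (t0 - int n - t0)) * N x"
    proof (rule comp[of _ "t0 - int n"])
      have "t0 - int n \<le> t0"
        by simp
      with bounds show
        "op_norm N (X t0 ** Q ** matrix_inv (X (t0 - int n)))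
           \<le> \<delta>\<^sub>1 * (1 + \<gamma>\<^sub>1) powi (t0 - int n - t0)"
        "op_norm N (X (t0 - int n) ** (mat 1 - P) ** matrix_inv (X t0))
           \<le> \<beta>\<^sub>2 * (1 + \<alpha>\<^sub>2) powi (t0 - int n - t0)"
        by blast+
      show "0 \<le> \<delta>\<^sub>1 * (1 + \<gamma>\<^sub>1) powi (t0 - int n - t0)"
        using bounds by (intro mult_nonneg_nonneg zero_le_power_int) linarith+
    qed
    then show "N ((Q ** (mat 1 - P)) *v x)
        \<le> (\<delta>\<^sub>1 * \<beta>\<^sub>2 * N x) * (1 + \<gamma>\<^sub>1) powi (- int n) * (1 + \<alpha>\<^sub>2) powi (- int n)"
      by (simp add: mult_ac)
  qed (use bounds in blast)+
  \<comment> \<open>Both vanishing products involve \<open>Q ** P\<close>: the first turns it into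
    \<open>P\<close>, the second into \<open>Q\<close>.\<close>
  ultimately have "(mat 1 - Q) ** P = 0" "Q ** (mat 1 - P) = 0"
    by (simp_all add: matrix_eq)
  then have "P = Q ** P" "Q = Q ** P"
    by (simp_all add: bounded_bilinear.diff_left[OF bounded_bilinear_matrix_mult]
        bounded_bilinear.diff_right[OF bounded_bilinear_matrix_mult])
  then show ?thesis
    by simp
qed

subsection \<open>Passage to the limiting system\<close>

text \<open>For fixed \<open>k\<close> the sequence on the left is the principal fundamental
  solution for the coefficient shifted by \<open>\<theta> k\<close>. Its value at \<open>t\<close>
  uses only the finitely many coefficients between \<open>t0\<close> and \<open>t\<close>, hence
  induction in both directions; the backward one needs continuity of inversion.\<close>

lemma tendsto_shifted_transition:
  fixes A X B Y :: "int \<Rightarrow> 'k::{real_normed_field, euclidean_space} ^ 'n::finite ^ 'n"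
  assumes A: "\<And>t. invertible (A t)" and B: "\<And>t. invertible (B t)"
    and X: "principal_fundamental_matrix A t0 X" and Y: "principal_fundamental_matrix B t0 Y"
    and lim: "\<And>t. (\<lambda>k. A (t + \<theta> k)) \<longlonglongrightarrow> B t"
  shows "(\<lambda>k. X (t + \<theta> k) ** matrix_inv (X (t0 + \<theta> k))) \<longlonglongrightarrow> Y t"
proof (induction t rule: int_induct[where k = t0])
  case base
  show ?case
    using Y by (simp add: principal_fundamental_matrix_def invertible_matrix_inv_right
        invertible_principal_fundamental_matrix[OF X A])
next
  case (step1 i)
  have "X (i + \<theta> k + 1) = A (i + \<theta> k) ** X (i + \<theta> k)" for k
    using X by (simp add: principal_fundamental_matrix_def)
  then have "X (i + 1 + \<theta> k) = A (i + \<theta> k) ** X (i + \<theta> k)" for k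
    by (simp add: ac_simps)
  then show ?case
    using tendsto_matrix_mult[OF lim[of i] step1(2)] Y
    by (simp add: principal_fundamental_matrix_def matrix_mul_assoc)
next
  case (step2 i)
  have step_back: "Z (j - 1) = matrix_inv (C (j - 1)) ** Z j"
    if "principal_fundamental_matrix C t0 Z" "\<And>t. invertible (C t)"
    for C Z :: "int \<Rightarrow> 'k ^ 'n ^ 'n" and j
  proof -
    have "Z (j - 1 + 1) = C (j - 1) ** Z (j - 1)"
      using that unfolding principal_fundamental_matrix_def by blast
    then show ?thesis
      by (simp add: matrix_mul_assoc invertible_matrix_inv_left that)
  qed
  have "X (i - 1 + \<theta> k) = matrix_inv (A (i - 1 + \<theta> k)) ** X (i + \<theta> k)" for k
    using step_back[OF X A, of "i + \<theta> k"] by (simp add: algebra_simps)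
  then show ?case
    using tendsto_matrix_mult[OF tendsto_matrix_inv[OF lim[of "i - 1"] A B] step2(2)] step_back[OF Y B, of i]
    by (simp add: matrix_mul_assoc)
qed

text \<open>The operator factors through time \<open>t0 + \<theta> k\<close> as a transition, the
  conjugate of \<open>R\<close>, and an inverse transition, and all three converge. \<open>R\<close>
  is arbitrary so that \<open>P\<close> and its complement are both covered.\<close>

lemma tendsto_shifted_conjugate:
  fixes A X B Y :: "int \<Rightarrow> 'k::{real_normed_field, euclidean_space} ^ 'n::finite ^ 'n"
  assumes A: "\<And>t. invertible (A t)" and B: "\<And>t. invertible (B t)"
    and X: "principal_fundamental_matrix A t0 X" and Y: "principal_fundamental_matrix B t0 Y"
    and lim: "\<And>t. (\<lambda>k. A (t + \<theta> k)) \<longlonglongrightarrow> B t"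
    and R: "(\<lambda>k. X (t0 + \<theta> k) ** R ** matrix_inv (X (t0 + \<theta> k))) \<longlonglongrightarrow> Q"
  shows "(\<lambda>k. X (t + \<theta> k) ** R ** matrix_inv (X (s + \<theta> k))) \<longlonglongrightarrow> Y t ** Q ** matrix_inv (Y s)"
proof -
  define U where "U t k = X (t + \<theta> k) ** matrix_inv (X (t0 + \<theta> k))" for t k
  note U = tendsto_shifted_transition[OF A B X Y lim, folded U_def]
  note invX = invertible_principal_fundamental_matrix[OF X A]
  have cancel: "M ** matrix_inv (X j) ** X j = M" "M ** X j ** matrix_inv (X j) = M"
    for M :: "'k ^ 'n ^ 'n" and j
    by (simp_all add: matrix_mul_assoc[symmetric] invertible_matrix_inv_left
        invertible_matrix_inv_right invX)
  \<comment> \<open>\<open>V s k\<close> is the inverse of \<open>U s k\<close>, so its limit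
    follows from that of \<open>U\<close>.\<close>
  define V where "V s k = X (t0 + \<theta> k) ** matrix_inv (X (s + \<theta> k))" for s k
  have UV: "U s k ** V s k = mat 1" "V s k ** U s k = mat 1" for s k
    by (simp_all add: U_def V_def matrix_mul_assoc cancel invertible_matrix_inv_right invX)
  then have "invertible (U s k)" for s k
    unfolding invertible_def by blast
  then have "(\<lambda>k. matrix_inv (U s k)) \<longlonglongrightarrow> matrix_inv (Y s)"
    by (intro tendsto_matrix_inv U invertible_principal_fundamental_matrix[OF Y B])
  then have "(\<lambda>k. V s k) \<longlonglongrightarrow> matrix_inv (Y s)"
    by (simp add: matrix_inv_eqI[OF UV])
  then have "(\<lambda>k. U t k ** (X (t0 + \<theta> k) ** R ** matrix_inv (X (t0 + \<theta> k))) ** V s k)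
      \<longlonglongrightarrow> Y t ** Q ** matrix_inv (Y s)"
    by (intro tendsto_matrix_mult U R)
  then show ?thesis
    by (simp add: U_def V_def matrix_mul_assoc cancel)
qed

text \<open>The roles of \<open>A\<close> and \<open>B\<close> are kept general because the result
  serves once along \<open>\<theta>\<close> and once along \<open>-\<theta>\<close>. The order of
  \<open>t\<close> and \<open>s\<close> matters for the estimates, not for the limits.\<close>

lemma exponential_dichotomy_limit:
  fixes A X B Y :: "int \<Rightarrow> 'k::{real_normed_field, euclidean_space} ^ 'n::finite ^ 'n"
  assumes N: "is_norm N" and A: "\<And>t. invertible (A t)" and B: "\<And>t. invertible (B t)"
    and X: "principal_fundamental_matrix A t0 X" and Y: "principal_fundamental_matrix B t0 Y"
    and lim: "\<And>t. (\<lambda>k. A (t + \<theta> k)) \<longlonglongrightarrow> B t"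
    and ed: "exponential_dichotomy N X P \<alpha>\<^sub>1 \<alpha>\<^sub>2 \<beta>\<^sub>1 \<beta>\<^sub>2"
  obtains Q where "exponential_dichotomy N Y Q \<alpha>\<^sub>1 \<alpha>\<^sub>2 \<beta>\<^sub>1 \<beta>\<^sub>2"
    "\<And>t s. (\<lambda>k. X (t + \<theta> k) ** P ** matrix_inv (X (s + \<theta> k)))
       \<longlonglongrightarrow> Y t ** Q ** matrix_inv (Y s)"
    "\<And>t s. (\<lambda>k. X (t + \<theta> k) ** (mat 1 - P) ** matrix_inv (X (s + \<theta> k)))
       \<longlonglongrightarrow> Y t ** (mat 1 - Q) ** matrix_inv (Y s)"
proof -
  define p where "p k = X (t0 + \<theta> k) ** P ** matrix_inv (X (t0 + \<theta> k))" for k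
  note invX = invertible_principal_fundamental_matrix[OF X A]
  have cancel: "M ** matrix_inv (X j) ** X j = M" for M :: "'k ^ 'n ^ 'n" and j
    by (simp add: matrix_mul_assoc[symmetric] invertible_matrix_inv_left invX)
  have p_idem: "p k ** p k = p k" for k
  proof -
    have "p k ** p k = X (t0 + \<theta> k) ** (P ** P) ** matrix_inv (X (t0 + \<theta> k))"
      by (simp add: p_def matrix_mul_assoc cancel)
    then show ?thesis
      using ed by (simp add: p_def exponential_dichotomy_def)
  qed
  \<comment> \<open>Conjugation fixes the identity, so convergence of \<open>p\<close> also gives
    that of the complementary projections.\<close>
  have p_compl: "X (t0 + \<theta> k) ** (mat 1 - P) ** matrix_inv (X (t0 + \<theta> k)) = mat 1 - p k" for k
    by (simp add: p_def bounded_bilinear.diff_left[OF bounded_bilinear_matrix_mult]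
        bounded_bilinear.diff_right[OF bounded_bilinear_matrix_mult]
        invertible_matrix_inv_right invX)
  \<comment> \<open>A subsequence \<open>r\<close> is allowed since compactness first yields
    convergence of \<open>p\<close> only along subsequences; \<open>r = id\<close> gives the final
    claim.\<close>
  have limits: "(\<lambda>k. X (t + \<theta> (r k)) ** P ** matrix_inv (X (s + \<theta> (r k))))
        \<longlonglongrightarrow> Y t ** Q ** matrix_inv (Y s)"
      "(\<lambda>k. X (t + \<theta> (r k)) ** (mat 1 - P) ** matrix_inv (X (s + \<theta> (r k))))
        \<longlonglongrightarrow> Y t ** (mat 1 - Q) ** matrix_inv (Y s)"
    if r: "strict_mono r" and Q: "(\<lambda>k. p (r k)) \<longlonglongrightarrow> Q" for r :: "nat \<Rightarrow> nat" and Q t s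
  proof -
    have lim': "(\<lambda>k. A (t + \<theta> (r k))) \<longlonglongrightarrow> B t" for t
      using LIMSEQ_subseq_LIMSEQ[OF lim r] by (simp add: o_def)
    show "(\<lambda>k. X (t + \<theta> (r k)) ** P ** matrix_inv (X (s + \<theta> (r k))))
        \<longlonglongrightarrow> Y t ** Q ** matrix_inv (Y s)"
      by (rule tendsto_shifted_conjugate[OF A B X Y lim']) (use Q in \<open>simp add: p_def\<close>)
    show "(\<lambda>k. X (t + \<theta> (r k)) ** (mat 1 - P) ** matrix_inv (X (s + \<theta> (r k))))
        \<longlonglongrightarrow> Y t ** (mat 1 - Q) ** matrix_inv (Y s)"
      by (rule tendsto_shifted_conjugate[OF A B X Y lim'])
        (unfold p_compl, intro tendsto_intros Q)
  qed
  have dich: "exponential_dichotomy N Y Q \<alpha>\<^sub>1 \<alpha>\<^sub>2 \<beta>\<^sub>1 \<beta>\<^sub>2"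
    if r: "strict_mono r" and Q: "(\<lambda>k. p (r k)) \<longlonglongrightarrow> Q" for r :: "nat \<Rightarrow> nat" and Q
  proof -
    have "(\<lambda>k. p (r k) ** p (r k)) \<longlonglongrightarrow> Q ** Q"
      by (intro tendsto_matrix_mult Q)
    then have "Q ** Q = Q"
      unfolding p_idem using Q by (rule LIMSEQ_unique)
    \<comment> \<open>The bound depends only on \<open>s - t\<close>, so the common shift cancels
      and the constants survive the limit.\<close>
    moreover have "op_norm N (Y t ** Q ** matrix_inv (Y s)) \<le> \<beta>\<^sub>1 * (1 + \<alpha>\<^sub>1) powi (s - t)"
      if "s \<le> t" for t s
    proof (rule op_norm_le_limit[OF N limits(1)[OF r Q]])
      fix k
      have "s + \<theta> (r k) \<le> t + \<theta> (r k)"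
        using that by simp
      then have "op_norm N (X (t + \<theta> (r k)) ** P ** matrix_inv (X (s + \<theta> (r k))))
          \<le> \<beta>\<^sub>1 * (1 + \<alpha>\<^sub>1) powi ((s + \<theta> (r k)) - (t + \<theta> (r k)))"
        using ed unfolding exponential_dichotomy_def by blast
      then show "op_norm N (X (t + \<theta> (r k)) ** P ** matrix_inv (X (s + \<theta> (r k))))
          \<le> \<beta>\<^sub>1 * (1 + \<alpha>\<^sub>1) powi (s - t)"
        by simp
    qed
    moreover have "op_norm N (Y t ** (mat 1 - Q) ** matrix_inv (Y s)) \<le> \<beta>\<^sub>2 * (1 + \<alpha>\<^sub>2) powi (t - s)"
      if "t \<le> s" for t s
    proof (rule op_norm_le_limit[OF N limits(2)[OF r Q]])
      fix k
      have "t + \<theta> (r k) \<le> s + \<theta> (r k)"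
        using that by simp
      then have "op_norm N (X (t + \<theta> (r k)) ** (mat 1 - P) ** matrix_inv (X (s + \<theta> (r k))))
          \<le> \<beta>\<^sub>2 * (1 + \<alpha>\<^sub>2) powi ((t + \<theta> (r k)) - (s + \<theta> (r k)))"
        using ed unfolding exponential_dichotomy_def by blast
      then show "op_norm N (X (t + \<theta> (r k)) ** (mat 1 - P) ** matrix_inv (X (s + \<theta> (r k))))
          \<le> \<beta>\<^sub>2 * (1 + \<alpha>\<^sub>2) powi (t - s)"
        by simp
    qed
    ultimately show ?thesis
      using ed by (simp add: exponential_dichotomy_def)
  qed
  \<comment> \<open>At equal times the exponent is 0, so \<open>\<beta>\<^sub>1\<close> bounds all
    the shifted projections.\<close>
  have "op_norm N (p k) \<le> \<beta>\<^sub>1 * (1 + \<alpha>\<^sub>1) powi ((t0 + \<theta> k) - (t0 + \<theta> k))" for k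
    using ed unfolding exponential_dichotomy_def p_def by blast
  then have bdd: "bounded (range p)"
    by (intro op_norm_bounded_imp_bounded[OF N, where b = \<beta>\<^sub>1]) simp
  have subseq: "\<exists>Q r'. strict_mono r' \<and> (\<lambda>k. p (r (r' k))) \<longlonglongrightarrow> Q" for r :: "nat \<Rightarrow> nat"
    using bounded_imp_convergent_subsequence[OF bounded_subset[OF bdd], of "p \<circ> r"]
    by (auto simp: o_def)
  obtain Q r where r: "strict_mono r" and Q: "(\<lambda>k. p (r k)) \<longlonglongrightarrow> Q"
    using subseq[of id] by auto
  \<comment> \<open>Otherwise some subsequence stays at distance at least \<open>e\<close> from
    \<open>Q\<close>. By compactness part of it converges to some \<open>Q'\<close>, again a
    dichotomy projection for \<open>Y\<close>, so uniqueness forces \<open>Q' = Q\<close>.\<close>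
  have "p \<longlonglongrightarrow> Q"
  proof (rule ccontr)
    assume "\<not> p \<longlonglongrightarrow> Q"
    then obtain e where e: "0 < e" "\<exists>\<^sub>F k in sequentially. e \<le> dist (p k) Q"
      by (auto simp: tendsto_iff not_eventually not_less)
    then have "infinite {k. e \<le> dist (p k) Q}"
      by (simp add: frequently_sequentially infinite_nat_iff_unbounded_le)
    then obtain q :: "nat \<Rightarrow> nat" where q: "strict_mono q" "\<And>k. e \<le> dist (p (q k)) Q"
      using infinite_enumerate by blast
    obtain Q' r' where r': "strict_mono r'" and Q': "(\<lambda>k. p (q (r' k))) \<longlonglongrightarrow> Q'"
      using subseq[of q] by blast
    have "strict_mono (\<lambda>k. q (r' k))"
      using strict_mono_o[OF q(1) r'] by (simp add: o_def)
    then have "exponential_dichotomy N Y Q' \<alpha>\<^sub>1 \<alpha>\<^sub>2 \<beta>\<^sub>1 \<beta>\<^sub>2"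
      using Q' by (rule dich)
    moreover have "Y t0 = mat 1"
      using Y by (simp add: principal_fundamental_matrix_def)
    ultimately have "Q' = Q"
      by (intro exponential_dichotomy_unique[OF N _
            invertible_principal_fundamental_matrix[OF Y B] _ dich[OF r Q]])
    moreover have "e \<le> dist Q' Q"
      by (rule LIMSEQ_le_const[OF tendsto_dist[OF Q' tendsto_const]]) (use q in auto)
    ultimately show False
      using e(1) by simp
  qed
  then show thesis
    using that[OF dich[OF r Q]] limits[of id Q] by (simp add: strict_mono_id)
qed

section \<open>Limits along \<open>\<theta>\<close> and the return along
  \<open>-\<theta>\<close>\<close>

theorem theorem4:
  fixes N :: "'k::{real_normed_field, euclidean_space} ^ 'n::finite \<Rightarrow> real"
    and A X :: "int \<Rightarrow> 'k ^ 'n ^ 'n"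
    and P :: "'k ^ 'n ^ 'n"
    and t0 :: int
    and \<alpha>\<^sub>1 \<alpha>\<^sub>2 \<beta>\<^sub>1 \<beta>\<^sub>2 :: real
  assumes "is_norm N"
    and "\<And>t. invertible (A t)"
    and "principal_fundamental_matrix A t0 X"
    and "exponential_dichotomy N X P \<alpha>\<^sub>1 \<alpha>\<^sub>2 \<beta>\<^sub>1 \<beta>\<^sub>2"
    and "almost_automorphic A"
  shows "\<forall>(\<theta> :: nat \<Rightarrow> int) Abar Xbar.
    limits_along A \<theta> Abar \<and> (\<forall>t. invertible (Abar t)) \<and>
    principal_fundamental_matrix Abar t0 Xbar \<longrightarrow>
    (\<exists>Pbar.
      Pbar ** Pbar = Pbar \<and>
      (\<forall>t s. s \<le> t \<longrightarrow>
        (\<lambda>k. X (t + \<theta> k) ** P ** matrix_inv (X (s + \<theta> k)))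
          \<longlonglongrightarrow> Xbar t ** Pbar ** matrix_inv (Xbar s)) \<and>
      (\<forall>t s. t \<le> s \<longrightarrow>
        (\<lambda>k. X (t + \<theta> k) ** (mat 1 - P) ** matrix_inv (X (s + \<theta> k)))
          \<longlonglongrightarrow> Xbar t ** (mat 1 - Pbar) ** matrix_inv (Xbar s)) \<and>
      exponential_dichotomy N Xbar Pbar \<alpha>\<^sub>1 \<alpha>\<^sub>2 \<beta>\<^sub>1 \<beta>\<^sub>2 \<and>
      (\<forall>t s. s \<le> t \<longrightarrow>
        (\<lambda>k. Xbar (t - \<theta> k) ** Pbar ** matrix_inv (Xbar (s - \<theta> k)))
          \<longlonglongrightarrow> X t ** P ** matrix_inv (X s)) \<and>
      (\<forall>t s. t \<le> s \<longrightarrow>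
        (\<lambda>k. Xbar (t - \<theta> k) ** (mat 1 - Pbar) ** matrix_inv (Xbar (s - \<theta> k)))
          \<longlonglongrightarrow> X t ** (mat 1 - P) ** matrix_inv (X s)))"
proof (intro allI impI, elim conjE)
  fix \<theta> :: "nat \<Rightarrow> int" and Abar Xbar :: "int \<Rightarrow> 'k ^ 'n ^ 'n"
  assume lim: "limits_along A \<theta> Abar" and inv: "\<forall>t. invertible (Abar t)"
    and Xbar: "principal_fundamental_matrix Abar t0 Xbar"
  note A = assms(2) and B = inv[rule_format]
  \<comment> \<open>The return limit is written as addition of \<open>- \<theta> k\<close>, so that
    the same limit lemma applies to the negated sequence.\<close>
  have fwd: "\<And>t. (\<lambda>k. A (t + \<theta> k)) \<longlonglongrightarrow> Abar t"
    and bwd: "\<And>t. (\<lambda>k. Abar (t + - \<theta> k)) \<longlonglongrightarrow> A t"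
    using lim by (auto simp: limits_along_def)
  obtain Q where Q: "exponential_dichotomy N Xbar Q \<alpha>\<^sub>1 \<alpha>\<^sub>2 \<beta>\<^sub>1 \<beta>\<^sub>2"
    and Qlim: "\<And>t s. (\<lambda>k. X (t + \<theta> k) ** P ** matrix_inv (X (s + \<theta> k)))
        \<longlonglongrightarrow> Xbar t ** Q ** matrix_inv (Xbar s)"
      "\<And>t s. (\<lambda>k. X (t + \<theta> k) ** (mat 1 - P) ** matrix_inv (X (s + \<theta> k)))
        \<longlonglongrightarrow> Xbar t ** (mat 1 - Q) ** matrix_inv (Xbar s)"
    by (rule exponential_dichotomy_limit[OF assms(1) A B assms(3) Xbar fwd assms(4)]) blast
  \<comment> \<open>Going back yields some dichotomy projection \<open>R\<close> for
    \<open>X\<close>, not yet known to be \<open>P\<close>; uniqueness for the original system then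
    identifies them.\<close>
  obtain R where R: "exponential_dichotomy N X R \<alpha>\<^sub>1 \<alpha>\<^sub>2 \<beta>\<^sub>1 \<beta>\<^sub>2"
    and Rlim: "\<And>t s. (\<lambda>k. Xbar (t + - \<theta> k) ** Q ** matrix_inv (Xbar (s + - \<theta> k)))
        \<longlonglongrightarrow> X t ** R ** matrix_inv (X s)"
      "\<And>t s. (\<lambda>k. Xbar (t + - \<theta> k) ** (mat 1 - Q) ** matrix_inv (Xbar (s + - \<theta> k)))
        \<longlonglongrightarrow> X t ** (mat 1 - R) ** matrix_inv (X s)"
    by (rule exponential_dichotomy_limit[OF assms(1) B A Xbar assms(3) bwd Q]) blast
  have "X t0 = mat 1"
    using assms(3) by (simp add: principal_fundamental_matrix_def)
  then have "R = P"
    by (rule exponential_dichotomy_unique[OF assms(1) _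
          invertible_principal_fundamental_matrix[OF assms(3) A] R assms(4)])
  moreover have "Q ** Q = Q"
    using Q by (simp add: exponential_dichotomy_def)
  ultimately show "\<exists>Pbar.
      Pbar ** Pbar = Pbar \<and>
      (\<forall>t s. s \<le> t \<longrightarrow>
        (\<lambda>k. X (t + \<theta> k) ** P ** matrix_inv (X (s + \<theta> k)))
          \<longlonglongrightarrow> Xbar t ** Pbar ** matrix_inv (Xbar s)) \<and>
      (\<forall>t s. t \<le> s \<longrightarrow>
        (\<lambda>k. X (t + \<theta> k) ** (mat 1 - P) ** matrix_inv (X (s + \<theta> k)))
          \<longlonglongrightarrow> Xbar t ** (mat 1 - Pbar) ** matrix_inv (Xbar s)) \<and>
      exponential_dichotomy N Xbar Pbar \<alpha>\<^sub>1 \<alpha>\<^sub>2 \<beta>\<^sub>1 \<beta>\<^sub>2 \<and>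
      (\<forall>t s. s \<le> t \<longrightarrow>
        (\<lambda>k. Xbar (t - \<theta> k) ** Pbar ** matrix_inv (Xbar (s - \<theta> k)))
          \<longlonglongrightarrow> X t ** P ** matrix_inv (X s)) \<and>
      (\<forall>t s. t \<le> s \<longrightarrow>
        (\<lambda>k. Xbar (t - \<theta> k) ** (mat 1 - Pbar) ** matrix_inv (Xbar (s - \<theta> k)))
          \<longlonglongrightarrow> X t ** (mat 1 - P) ** matrix_inv (X s))"
    using Q Qlim Rlim by (intro exI[of _ Q]) simp
qed

end
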